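(* Let $X$ be a connected bipartite graph with a unique perfect matching. If $X$ is not the path on two vertices, then $X$ does not admit (adjacency) perfect state transfer between any two distinct vertices.
   Context: Graphs are finite, simple and undirected. Let $A$ be the adjacency matrix of $X$ and, for a vertex $u$, let $\mathbf{e}_u$ be its characteristic vector. There is (adjacency) perfect state transfer between distinct vertices $u$ and $v$ if there exist a real $t\geq 0$ and $\gamma\in\mathbb{C}$ with $\exp(\mathrm{i}tA)\mathbf{e}_u=\gamma\mathbf{e}_v$. *)

theory Defs
  imports "HOL-Analysis.Analysis" "Graph_Theory.Graph_Theory"
begin

text \<open>A finite simple undirected graph is a \<^locale>\<open>pair_graph\<close>: a finite, loop-free,
  symmetric digraph, in which each edge is represented by its two opposite arcs.\<close>

definition edges :: "'v pair_pre_digraph \<Rightarrow> 'v set set" where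
  "edges X = {{u, v} | u v. (u, v) \<in> parcs X}"

definition bipartite :: "'v pair_pre_digraph \<Rightarrow> bool" where
  "bipartite X \<longleftrightarrow> (\<exists>U W. U \<union> W = pverts X \<and> U \<inter> W = {} \<and>
     (\<forall>(u, v) \<in> parcs X. u \<in> U \<and> v \<in> W \<or> u \<in> W \<and> v \<in> U))"

definition perfect_matching :: "'v pair_pre_digraph \<Rightarrow> 'v set set \<Rightarrow> bool" where
  "perfect_matching X M \<longleftrightarrow> M \<subseteq> edges X \<and> (\<forall>v \<in> pverts X. \<exists>!e. e \<in> M \<and> v \<in> e)"

definition path_graph :: "nat \<Rightarrow> nat pair_pre_digraph" where
  "path_graph n = \<lparr>pverts = {..<n}, parcs = {(i, j). i < n \<and> j < n \<and> (j = Suc i \<or> i = Suc j)}\<rparr>"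

definition adjacency_matrix :: "'v::finite pair_pre_digraph \<Rightarrow> complex^'v^'v" where
  "adjacency_matrix X = (\<chi> u v. if (u, v) \<in> parcs X then 1 else 0)"

text \<open>The operations \<open>*\<close> and \<open>^\<close> on type \<^typ>\<open>complex^'v^'v\<close> are componentwise, and \<^const>\<open>exp\<close>
  is not available there; so the exponential is the series over powers with respect to \<open>**\<close>.\<close>

primrec matrix_power :: "complex^'v^'v::finite \<Rightarrow> nat \<Rightarrow> complex^'v^'v" where
  "matrix_power M 0 = mat 1"
| "matrix_power M (Suc k) = M ** matrix_power M k"

definition matrix_exp :: "complex^'v^'v::finite \<Rightarrow> complex^'v^'v" where
  "matrix_exp M = (\<Sum>k. matrix_power M k /\<^sub>R fact k)"

definition perfect_state_transfer :: "'v::finite pair_pre_digraph \<Rightarrow> 'v \<Rightarrow> 'v \<Rightarrow> bool" where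
  "perfect_state_transfer X u v \<longleftrightarrow>
     (\<exists>t::real. t \<ge> 0 \<and> (\<exists>\<gamma>::complex.
        matrix_exp (\<chi> a b. \<i> * complex_of_real t * adjacency_matrix X $ a $ b) *v axis u 1 = \<gamma> *s axis v 1))"

end

theory Submission
  imports Defs "HOL-Computational_Algebra.Fundamental_Theorem_Algebra"
begin

text \<open>
  Since \<open>X\<close> is bipartite, perfect state transfer from \<open>u\<close> at time \<open>t\<close> gives
  \<open>exp(-itA) e\<^sub>u = \<plusminus> exp(itA) e\<^sub>u\<close>, so every eigenvalue of \<open>A\<close> on the cyclic subspace generated by
  \<open>e\<^sub>u\<close> is an integer multiple of \<open>\<pi>/2t\<close>. Hence the minimal polynomial of \<open>e\<^sub>u\<close> with respect to \<open>A\<^sup>2\<close>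
  has roots \<open>s n\<^sup>2\<close> with \<open>s = (\<pi>/2t)\<^sup>2\<close> and integers \<open>n\<close>; its coefficients are rational, and the sum of
  the roots shows that \<open>s\<close> is rational. The unique perfect matching leaves a single term in the
  Leibniz expansion of \<open>det A\<close>, so \<open>det A = \<plusminus>1\<close> and the inverse of \<open>A\<close> is integral. An
  integral eigenvector of \<open>A\<^sup>2\<close> for a rational eigenvalue \<open>\<eta> > 0\<close> then stays integral under
  multiplication by all powers of \<open>\<eta>\<close>, positive and negative, which forces \<open>\<eta> = 1\<close>. As \<open>A\<close> is
  symmetric, \<open>A\<^sup>2 e\<^sub>u = e\<^sub>u\<close>: the vertex \<open>u\<close> has one neighbour, whose only neighbour is \<open>u\<close>.
\<close>

section \<open>Convergence and basic properties of the matrix exponential\<close>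

lemma matrix_vector_mult_smult: "M *v (c *s x) = c *s (M *v x)"
  for M :: "'a::comm_semiring_1^'n^'m"
  by (simp add: matrix_vector_mult_def vec_eq_iff sum_distrib_left mult_ac)

text \<open>The sum of all entry norms dominates every row sum, so each further factor
  \<open>M\<close> costs at most one factor of it.\<close>

lemma norm_matrix_power_entry_le:
  "norm (matrix_power M k $ i $ j) \<le> (\<Sum>a\<in>UNIV. \<Sum>b\<in>UNIV. norm (M $ a $ b)) ^ k"
proof (induction k arbitrary: i)
  case 0
  then show ?case by (simp add: mat_def)
next
  case (Suc k)
  let ?C = "\<Sum>a\<in>UNIV. \<Sum>b\<in>UNIV. norm (M $ a $ b)"
  have "norm (matrix_power M (Suc k) $ i $ j) \<le> (\<Sum>b\<in>UNIV. norm (M $ i $ b * matrix_power M k $ b $ j))"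
    by (simp add: matrix_matrix_mult_def norm_sum)
  also have "\<dots> \<le> (\<Sum>b\<in>UNIV. norm (M $ i $ b) * ?C ^ k)"
    by (intro sum_mono) (simp add: norm_mult mult_left_mono Suc.IH)
  also have "\<dots> = (\<Sum>b\<in>UNIV. norm (M $ i $ b)) * ?C ^ k"
    by (simp add: sum_distrib_right)
  also have "\<dots> \<le> ?C * ?C ^ k"
    by (intro mult_right_mono member_le_sum[of i UNIV "\<lambda>a. \<Sum>b\<in>UNIV. norm (M $ a $ b)"])
       (auto intro!: sum_nonneg zero_le_power)
  finally show ?case by simp
qed

lemma summable_matrix_exp: "summable (\<lambda>k. matrix_power M k /\<^sub>R fact k)"
  for M :: "complex^'n::finite^'n"
proof (rule summable_comparison_test')
  let ?C = "\<Sum>a\<in>UNIV. \<Sum>b\<in>UNIV. norm (M $ a $ b)"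
  let ?n = "real (CARD('n))"
  show "summable (\<lambda>k. ?n * ?n * (?C ^ k /\<^sub>R fact k))"
    by (intro summable_mult summable_exp_generic)
  fix k :: nat
  have "norm (matrix_power M k) \<le> (\<Sum>i\<in>UNIV. \<Sum>j\<in>UNIV. norm (matrix_power M k $ i $ j))"
    unfolding norm_vec_def by (rule order_trans[OF L2_set_le_sum]) (auto intro!: sum_mono L2_set_le_sum)
  also have "\<dots> \<le> (\<Sum>i\<in>(UNIV::'n set). \<Sum>j\<in>(UNIV::'n set). ?C ^ k)"
    by (intro sum_mono norm_matrix_power_entry_le)
  finally have "norm (matrix_power M k) \<le> ?n * ?n * ?C ^ k" by simp
  then show "norm (matrix_power M k /\<^sub>R fact k) \<le> ?n * ?n * (?C ^ k /\<^sub>R fact k)"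
    by (simp add: divide_right_mono divide_inverse mult.commute mult_left_mono)
qed

text \<open>Carries facts about powers over to \<open>matrix_exp\<close>: entries, the action on a
  vector and one-sided products are all bounded linear.\<close>

lemma bounded_linear_matrix_exp_sums:
  assumes "bounded_linear h"
  shows "(\<lambda>k. h (matrix_power M k) /\<^sub>R fact k) sums h (matrix_exp M)"
  using bounded_linear.sums[OF assms summable_sums[OF summable_matrix_exp[of M]]]
  by (simp add: matrix_exp_def linear_simps(5)[OF assms])

lemma matrix_exp_eigenvector:
  fixes M :: "complex^'n::finite^'n"
  assumes "M *v w = \<mu> *s w"
  shows "matrix_exp M *v w = exp \<mu> *s w"
proof -
  have pow: "matrix_power M k *v w = \<mu> ^ k *s w" for k
    by (induction k)
       (simp_all add: assms matrix_vector_mult_smult mult.commute flip: matrix_vector_mul_assoc)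
  have "linear (\<lambda>N::complex^'n^'n. (N *v w) $ i)" for i
    by (rule linearI) (simp_all add: matrix_vector_mult_def sum.distrib algebra_simps scaleR_sum_right)
  then have "(\<lambda>k. (matrix_power M k *v w) $ i /\<^sub>R fact k) sums ((matrix_exp M *v w) $ i)" for i
    by (intro bounded_linear_matrix_exp_sums) (simp add: linear_conv_bounded_linear)
  moreover have "(\<lambda>k. (\<mu> ^ k *s w) $ i /\<^sub>R fact k) sums (exp \<mu> * w $ i)" for i
    using sums_mult2[OF exp_converges[of \<mu>], of "w $ i"] by simp
  ultimately show ?thesis
    unfolding pow by (auto simp: vec_eq_iff intro: sums_unique2)
qed

lemma matrix_exp_commute:
  fixes M N :: "complex^'n::finite^'n"
  assumes "N ** M = M ** N"
  shows "N ** matrix_exp M = matrix_exp M ** N"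
proof -
  have pow: "N ** matrix_power M k = matrix_power M k ** N" for k
    by (induction k) (simp_all, metis assms matrix_mul_assoc)
  have "linear (\<lambda>P. N ** P)" "linear (\<lambda>P. P ** N)"
    by (auto intro!: linearI simp: matrix_matrix_mult_def vec_eq_iff sum.distrib algebra_simps scaleR_sum_right)
  then have "(\<lambda>k. (N ** matrix_power M k) /\<^sub>R fact k) sums (N ** matrix_exp M)"
    "(\<lambda>k. (matrix_power M k ** N) /\<^sub>R fact k) sums (matrix_exp M ** N)"
    by (intro bounded_linear_matrix_exp_sums; simp add: linear_conv_bounded_linear)+
  then show ?thesis
    unfolding pow by (rule sums_unique2)
qed

text \<open>With \<open>D\<close> the diagonal matrix of \<open>d\<close>, the hypotheses say
  \<open>N = D M D\<close> and \<open>D D = 1\<close>, so conjugation passes through powers and the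
  series. The signs of a bipartition will give \<open>N = - M\<close>.\<close>

lemma matrix_exp_diagonal_conj:
  fixes M N :: "complex^'n::finite^'n"
  assumes N: "\<And>a b. N $ a $ b = d a * d b * M $ a $ b" and d: "\<And>a. d a * d a = 1"
  shows "matrix_exp N $ a $ b = d a * d b * matrix_exp M $ a $ b"
proof -
  have pow: "matrix_power N k $ a $ b = d a * d b * matrix_power M k $ a $ b" for k a b
  proof (induction k arbitrary: a)
    case 0
    then show ?case by (simp add: mat_def d)
  next
    case (Suc k)
    \<comment> \<open>The inner index contributes \<open>d c\<close> from both factors, and its
      square is 1.\<close>
    have "N $ a $ c * matrix_power N k $ c $ b = d a * d b * (M $ a $ c * matrix_power M k $ c $ b)" for c
    proof -
      have "N $ a $ c * matrix_power N k $ c $ b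
          = (d c * d c) * (d a * d b * (M $ a $ c * matrix_power M k $ c $ b))"
        by (simp add: N Suc.IH)
      then show ?thesis by (simp add: d)
    qed
    then show ?case by (simp add: matrix_matrix_mult_def sum_distrib_left)
  qed
  have entry: "(\<lambda>k. matrix_power P k $ a $ b /\<^sub>R fact k) sums (matrix_exp P $ a $ b)" for P :: "complex^'n^'n"
    by (rule bounded_linear_matrix_exp_sums)
       (intro bounded_linear_compose[OF bounded_linear_vec_nth] bounded_linear_vec_nth)
  show ?thesis
    using entry[of N] sums_mult[OF entry[of M], of "d a * d b"]
    unfolding pow by (auto intro: sums_unique2)
qed

section \<open>Polynomials in a matrix applied to a vector, and rational functionals\<close>

text \<open>The vector \<open>p(B) x\<close> by Horner's scheme, so that the matrix
  \<open>p(B)\<close> is never formed.\<close>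

definition poly_act :: "'a::field^'n^'n \<Rightarrow> 'a^'n \<Rightarrow> 'a poly \<Rightarrow> 'a^'n" where
  "poly_act B x p = fold_coeffs (\<lambda>a y. a *s x + B *v y) p 0"

lemma poly_act_0 [simp]: "poly_act B x 0 = 0"
  by (simp add: poly_act_def)

lemma poly_act_pCons [simp]: "poly_act B x (pCons a p) = a *s x + B *v poly_act B x p"
  by (cases "p = 0 \<and> a = 0") (auto simp: poly_act_def)

lemma poly_act_add: "poly_act B x (p + q) = poly_act B x p + poly_act B x q"
  by (induction p q rule: poly_induct2)
     (simp_all add: vec.scale_left_distrib matrix_vector_right_distrib)

lemma poly_act_smult: "poly_act B x (smult c p) = c *s poly_act B x p"
  by (induction p) (simp_all add: vec.scale_right_distrib matrix_vector_mult_smult)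

lemma poly_act_diff: "poly_act B x (p - q) = poly_act B x p - poly_act B x q"
  using poly_act_add[of B x "p - q" q] by simp

lemma poly_act_sum: "poly_act B x (sum f S) = (\<Sum>i\<in>S. poly_act B x (f i))"
  by (induction S rule: infinite_finite_induct) (simp_all add: poly_act_add)

lemma poly_act_linear_factor:
  "poly_act B x ([:- a, 1:] * p) = B *v poly_act B x p - a *s poly_act B x p"
  by (simp add: poly_act_diff poly_act_smult)

text \<open>Among the vectors \<open>B^i x\<close> in a finite-dimensional space, either two
  coincide or there is a linear dependence.\<close>

lemma annihilating_poly_exists:
  fixes B :: "complex^'n::finite^'n"
  shows "\<exists>p. p \<noteq> 0 \<and> poly_act B x p = 0"
proof (cases "inj (\<lambda>i. poly_act B x (monom 1 i))")
  case False
  then obtain i j where ij: "i \<noteq> j" "poly_act B x (monom 1 i) = poly_act B x (monom 1 j)"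
    by (auto simp: inj_def)
  have "coeff (monom 1 i - monom 1 j) i \<noteq> (0::complex)"
    using ij by simp
  then have "monom 1 i - monom 1 j \<noteq> (0::complex poly)"
    by (metis coeff_0)
  then show ?thesis
    using ij by (intro exI[of _ "monom 1 i - monom 1 j"]) (simp add: poly_act_diff)
next
  case True
  let ?v = "\<lambda>i. poly_act B x (monom 1 i)"
  have "infinite (range ?v)"
    using True by (simp add: finite_image_iff)
  \<comment> \<open>Dependence is over the reals here; its coefficients are embedded into the
    complex numbers below.\<close>
  then have "dependent (range ?v)"
    using independent_imp_finite by blast
  then obtain T u w where T: "finite T" "T \<subseteq> range ?v" "(\<Sum>v\<in>T. u v *\<^sub>R v) = 0" "w \<in> T" "u w \<noteq> 0"
    unfolding dependent_explicit by blast
  obtain I where I: "T = ?v ` I" "finite I"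
    using T(1,2) by (metis finite_subset_image)
  define p where "p = (\<Sum>i\<in>I. monom (complex_of_real (u (?v i))) i)"
  have "poly_act B x p = (\<Sum>i\<in>I. u (?v i) *\<^sub>R ?v i)"
    unfolding p_def poly_act_sum
  proof (rule sum.cong[OF refl])
    fix i
    have "monom (complex_of_real (u (?v i))) i = smult (complex_of_real (u (?v i))) (monom 1 i)"
      by (simp add: smult_monom)
    then show "poly_act B x (monom (complex_of_real (u (?v i))) i) = u (?v i) *\<^sub>R ?v i"
      by (simp add: poly_act_smult vec_eq_iff scaleR_conv_of_real[where 'a = complex])
  qed
  also have "\<dots> = (\<Sum>v\<in>T. u v *\<^sub>R v)"
    unfolding I(1) by (subst sum.reindex) (auto intro: inj_on_subset[OF True])
  finally have "poly_act B x p = 0" using T by simp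
  moreover obtain i where i: "i \<in> I" "w = ?v i"
    using T(4) I(1) by blast
  have "coeff p i = u w"
    using i I(2) by (simp add: p_def coeff_sum sum.delta)
  then have "p \<noteq> 0" using T(5) by auto
  ultimately show ?thesis by blast
qed

text \<open>Vieta's formula for the sum of the roots: a new factor adds \<open>- a\<close> times the
  leading coefficient 1 to the subleading one.\<close>

lemma coeff_prod_linear_factors:
  fixes A :: "'a::idom multiset"
  assumes "A \<noteq> {#}"
  shows "coeff (\<Prod>x\<in>#A. [:- x, 1:]) (size A - 1) = - (\<Sum>x\<in>#A. x)"
proof -
  have deg: "degree (\<Prod>x\<in>#A. [:- x, 1:]) = size A \<and> lead_coeff (\<Prod>x\<in>#A. [:- x, 1:]) = 1"
    for A :: "'a multiset"
  proof (induction A)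
    case (add a A)
    then have "(\<Prod>x\<in>#A. [:- x, 1:]) \<noteq> 0" by auto
    with add have "degree (\<Prod>x\<in>#add_mset a A. [:- x, 1:]) = size (add_mset a A)"
      by (auto simp: degree_mult_eq simp del: mult_pCons_left)
    moreover have "lead_coeff (\<Prod>x\<in>#add_mset a A. [:- x, 1:]) = 1"
      using add unfolding image_mset_add_mset prod_mset.add_mset lead_coeff_mult by auto
    ultimately show ?case ..
  qed simp
  show ?thesis
    using assms
  proof (induction A)
    case (add a A)
    let ?P = "\<Prod>x\<in>#A. [:- x, 1:]"
    show ?case
    proof (cases "A = {#}")
      case False
      then obtain n where n: "size A = Suc n"
        by (metis size_eq_0_iff_empty not0_implies_Suc)
      then have "coeff ?P (Suc n) = 1"
        using deg[of A] by metis
      then show ?thesis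
        using add.IH[OF False] n by simp
    qed simp
  qed simp
qed

text \<open>Extends \<open>{z}\<close> to a basis of the complex numbers over the rationals. Applied
  coordinatewise, such a functional preserves linear equations with rational coefficients and makes
  their solutions rational.\<close>

lemma rational_functional_exists:
  fixes z :: complex
  assumes "z \<noteq> 0"
  obtains f where "\<And>x y. f (x + y) = f x + f y" "\<And>q x. f (of_rat q * x) = q * f x" "f z = (1::rat)"
proof -
  interpret vector_space_pair "\<lambda>q x. of_rat q * x :: complex" "(*) :: rat \<Rightarrow> rat \<Rightarrow> rat"
    by unfold_locales (simp_all add: algebra_simps of_rat_add of_rat_mult)
  have "vs1.independent {z}"
    using assms by simp
  from linear_independent_extend[OF this, of "\<lambda>_. 1"] obtain f
    where f: "Vector_Spaces.linear (\<lambda>q x. of_rat q * x) (*) f" "f z = 1"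
    by auto
  show thesis
    using linear_add[OF f(1)] linear_scale[OF f(1)] f(2) by (rule that)
qed

section \<open>The unique perfect matching and the determinant\<close>

lemma pair_graph_sym: "pair_graph X \<Longrightarrow> (a, b) \<in> parcs X \<Longrightarrow> (b, a) \<in> parcs X"
  using pair_sym_digraph.pair_sym_arcs[of X]
  by (auto simp: pair_graph_def pair_pseudo_graph_def symmetric_def dest: symD)

text \<open>A vertex of \<open>U\<close> is covered by its own edge, a vertex of \<open>W\<close> by
  the edge from its preimage under \<open>p\<close>. Exchanging \<open>U\<close> and
  \<open>W\<close> gives the matching formed by the values of \<open>p\<close> on
  \<open>W\<close>.\<close>

lemma perfect_matching_of_permutation:
  assumes X: "pverts X = UNIV" "U \<union> W = UNIV" "U \<inter> W = {}"
    and bip: "\<And>a b. (a, b) \<in> parcs X \<Longrightarrow> a \<in> U \<and> b \<in> W \<or> a \<in> W \<and> b \<in> U"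
    and p: "bij p" "\<And>x. (x, p x) \<in> parcs X"
  shows "perfect_matching X {{x, p x} | x. x \<in> U}"
  unfolding perfect_matching_def
proof (intro conjI ballI)
  show "{{x, p x} | x. x \<in> U} \<subseteq> edges X"
    using p(2) by (auto simp: edges_def)
  have pW: "p x \<notin> U" if "x \<in> U" for x
    using bip[OF p(2)[of x]] that X by auto
  fix y
  show "\<exists>!e. e \<in> {{x, p x} | x. x \<in> U} \<and> y \<in> e"
  proof (cases "y \<in> U")
    case True
    then show ?thesis
      using pW by (intro ex1I[of _ "{y, p y}"]) auto
  next
    case False
    obtain x where x: "p x = y"
      using p(1) by (metis bij_pointE)
    then have xU: "x \<in> U"
      using bip[OF p(2)[of x]] False by auto
    show ?thesis
    proof (rule ex1I[of _ "{x, p x}"])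
      show "{x, p x} \<in> {{x, p x} | x. x \<in> U} \<and> y \<in> {x, p x}"
        using xU x by blast
      fix e assume "e \<in> {{x, p x} | x. x \<in> U} \<and> y \<in> e"
      then obtain x' where e: "e = {x', p x'}" "x' \<in> U" "y \<in> {x', p x'}"
        by blast
      with False x have "p x' = p x" by auto
      with p(1) have "x' = x" by (simp add: bij_def inj_eq)
      with e(1) show "e = {x, p x}" by simp
    qed
  qed
qed

text \<open>A nonzero Leibniz term comes from a permutation along arcs, and the only such
  permutation is the involution \<open>m\<close> that swaps matched vertices.\<close>

lemma det_adjacency_matrix_unimodular:
  fixes X :: "'v::finite pair_pre_digraph"
  assumes X: "pair_graph X" "pverts X = UNIV" "bipartite X" "\<exists>!M. perfect_matching X M"
  shows "det (adjacency_matrix X) \<in> {1, - 1}"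
proof -
  obtain M where M: "perfect_matching X M" and M_unique: "\<And>N. perfect_matching X N \<Longrightarrow> N = M"
    using X(4) by auto
  have same_edge: "e = e'" if "e \<in> M" "e' \<in> M" "x \<in> e" "x \<in> e'" for e e' x
    using M that unfolding perfect_matching_def X(2) by blast
  have "\<exists>y. {x, y} \<in> M \<and> (x, y) \<in> parcs X" for x
  proof -
    obtain e where e: "e \<in> M" "x \<in> e"
      using M unfolding perfect_matching_def X(2) by blast
    then obtain a b where ab: "e = {a, b}" "(a, b) \<in> parcs X"
      using M unfolding perfect_matching_def edges_def by blast
    show ?thesis
    proof (cases "x = a")
      case True
      with e ab show ?thesis by auto
    next
      case False
      with e(2) ab(1) have "x = b" by auto
      with e ab pair_graph_sym[OF X(1)] show ?thesis by (auto simp: insert_commute)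
    qed
  qed
  then obtain m where m: "\<And>x. {x, m x} \<in> M" "\<And>x. (x, m x) \<in> parcs X"
    by metis
  have "m (m x) = x" for x
    using same_edge[OF m(1)[of x] m(1)[of "m x"], of "m x"] by (auto simp: doubleton_eq_iff)
  then have bij_m: "bij m"
    by (rule involuntory_imp_bij)
  obtain U W where UW: "U \<union> W = UNIV" "U \<inter> W = {}"
      "\<And>a b. (a, b) \<in> parcs X \<Longrightarrow> a \<in> U \<and> b \<in> W \<or> a \<in> W \<and> b \<in> U"
    using X(2,3) unfolding bipartite_def by (metis (no_types, lifting) case_prodD)
  have perm_unique: "p = m" if p: "bij p" "\<And>x. (x, p x) \<in> parcs X" for p
  proof
    fix x
    have "W \<union> U = UNIV" "W \<inter> U = {}" "\<And>a b. (a, b) \<in> parcs X \<Longrightarrow> a \<in> W \<and> b \<in> U \<or> a \<in> U \<and> b \<in> W"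
      using UW by blast+
    \<comment> \<open>The restrictions of \<open>p\<close> to the two colour classes give two
      perfect matchings; both must be \<open>M\<close>, so \<open>p\<close> is determined on all
      vertices.\<close>
    then have "{{x, p x} | x. x \<in> U} = M" "{{x, p x} | x. x \<in> W} = M"
      using perfect_matching_of_permutation[OF X(2) UW p]
        perfect_matching_of_permutation[OF X(2) _ _ _ p, of W U] M_unique by blast+
    moreover have "x \<in> U \<or> x \<in> W" using UW by blast
    ultimately have "{x, p x} \<in> M" by blast
    from same_edge[OF this m(1)[of x], of x] show "p x = m x"
      by (auto simp: doubleton_eq_iff)
  qed
  have "det (adjacency_matrix X)
      = (\<Sum>p | p permutes UNIV. of_int (sign p) * (\<Prod>i\<in>UNIV. adjacency_matrix X $ i $ p i))"
    by (simp add: det_def)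
  also have "\<dots> = (\<Sum>p\<in>{m}. of_int (sign p) * (\<Prod>i\<in>UNIV. adjacency_matrix X $ i $ p i))"
  proof (rule sum.mono_neutral_right)
    show "{m} \<subseteq> {p. p permutes UNIV}"
      using bij_imp_permutes[OF bij_m] by simp
    show "\<forall>p\<in>{p. p permutes UNIV} - {m}. of_int (sign p) * (\<Prod>i\<in>UNIV. adjacency_matrix X $ i $ p i) = 0"
    proof
      fix p assume p: "p \<in> {p. p permutes (UNIV::'v set)} - {m}"
      then have "bij p" by (auto simp: permutes_bij)
      with p perm_unique obtain x where "(x, p x) \<notin> parcs X" by blast
      then have "adjacency_matrix X $ x $ p x = 0"
        by (simp add: adjacency_matrix_def)
      then show "of_int (sign p) * (\<Prod>i\<in>UNIV. adjacency_matrix X $ i $ p i) = 0"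
        by auto
    qed
  qed simp
  also have "\<dots> = of_int (sign m)"
    by (simp add: adjacency_matrix_def m(2))
  finally show ?thesis
    by (simp add: sign_def)
qed

section \<open>Integral matrices with determinant 1 or -1\<close>

lemma det_in_Ints:
  fixes M :: "'a::comm_ring_1^'n::finite^'n"
  assumes "\<And>i j. M $ i $ j \<in> \<int>"
  shows "det M \<in> \<int>"
  unfolding det_def by (intro Ints_sum Ints_mult Ints_prod Ints_of_int assms)

text \<open>Cramer's rule writes \<open>x $ k\<close> as an integral determinant divided by 1 or
  -1.\<close>

lemma unimodular_solution_Ints:
  fixes A :: "'a::field^'n::finite^'n"
  assumes A: "\<And>i j. A $ i $ j \<in> \<int>" "det A \<in> {1, - 1}" and b: "\<And>i. (A *v x) $ i \<in> \<int>"
  shows "x $ k \<in> \<int>"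
proof -
  have "det A \<noteq> 0" using A(2) by auto
  from cramer[OF this, of x "A *v x"]
  have "x $ k = det (\<chi> i j. if j = k then (A *v x) $ i else A $ i $ j) / det A"
    by (metis (no_types, lifting) vec_lambda_beta)
  moreover have "det (\<chi> i j. if j = k then (A *v x) $ i else A $ i $ j) \<in> \<int>"
    by (rule det_in_Ints) (simp add: A(1) b)
  ultimately show ?thesis using A(2) by auto
qed

lemma matrix_vector_mult_Ints:
  fixes A :: "'a::ring_1^'n::finite^'m"
  assumes "\<And>i j. A $ i $ j \<in> \<int>" "\<And>i. x $ i \<in> \<int>"
  shows "(A *v x) $ i \<in> \<int>"
  by (simp add: matrix_vector_mult_def Ints_sum Ints_mult assms)

text \<open>A nonzero \<open>z\<close> would yield integers with positive absolute values tending to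
  0.\<close>

lemma decaying_Ints_eq_0:
  fixes z :: complex
  assumes r: "0 < r" "r < 1" and z: "\<And>k. complex_of_real r ^ k * z \<in> \<int>"
  shows "z = 0"
proof (rule ccontr)
  assume "z \<noteq> 0"
  then obtain k where k: "r ^ k < 1 / norm z"
    using real_arch_pow_inv[of "1 / norm z" r] r by auto
  obtain n where n: "complex_of_real r ^ k * z = of_int n"
    using z[of k] by (auto elim: Ints_cases)
  have "norm (complex_of_real r ^ k * z) = r ^ k * norm z"
    using r by (simp add: norm_mult norm_power)
  then have "\<bar>real_of_int n\<bar> = r ^ k * norm z"
    using n by (simp del: of_real_power)
  moreover have "0 < r ^ k * norm z" "r ^ k * norm z < 1"
    using k r \<open>z \<noteq> 0\<close> by (auto simp: field_simps)
  ultimately have "0 < \<bar>real_of_int n\<bar>" "\<bar>real_of_int n\<bar> < 1"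
    by simp_all
  then show False by simp
qed

lemma unimodular_square_eigenvalue:
  fixes A :: "complex^'n::finite^'n"
  assumes A: "\<And>i j. A $ i $ j \<in> \<int>" "det A \<in> {1, - 1}"
    and w: "\<And>i. w $ i \<in> \<int>" "w \<noteq> 0" "A *v (A *v w) = complex_of_real \<eta> *s w" and "\<eta> > 0"
  shows "\<eta> = 1"
proof -
  obtain a where a: "w $ a \<noteq> 0"
    using w(2) by (auto simp: vec_eq_iff)
  have pos: "(complex_of_real \<eta> ^ k *s w) $ i \<in> \<int>" for k i
  proof (induction k arbitrary: i)
    case 0
    then show ?case using w(1) by simp
  next
    case (Suc k)
    have "complex_of_real \<eta> ^ Suc k *s w = A *v (A *v (complex_of_real \<eta> ^ k *s w))"
      by (simp add: matrix_vector_mult_smult w(3) mult.commute)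
    then show ?case
      by (simp only:) (intro matrix_vector_mult_Ints A(1) Suc.IH)
  qed
  have neg: "(complex_of_real (1 / \<eta>) ^ k *s w) $ i \<in> \<int>" for k i
  proof (induction k arbitrary: i)
    case 0
    then show ?case using w(1) by simp
  next
    case (Suc k)
    have "A *v (A *v (complex_of_real (1 / \<eta>) ^ Suc k *s w)) = complex_of_real (1 / \<eta>) ^ k *s w"
      using \<open>\<eta> > 0\<close> by (simp add: matrix_vector_mult_smult w(3))
    then have "(A *v (A *v (complex_of_real (1 / \<eta>) ^ Suc k *s w))) $ i \<in> \<int>" for i
      using Suc.IH by metis
    \<comment> \<open>Integrality is pulled back through the two factors \<open>A\<close> one at a
      time.\<close>
    from unimodular_solution_Ints[OF A unimodular_solution_Ints[OF A this]] show ?case .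
  qed
  have "\<not> \<eta> < 1"
    using decaying_Ints_eq_0[of \<eta> "w $ a"] pos \<open>\<eta> > 0\<close> a by auto
  moreover have "\<not> 1 / \<eta> < 1"
    using decaying_Ints_eq_0[of "1 / \<eta>" "w $ a"] neg \<open>\<eta> > 0\<close> a by auto
  ultimately show ?thesis
    using \<open>\<eta> > 0\<close> by (auto simp: field_simps)
qed

section \<open>Connectedness and recognition of the path on two vertices\<close>

lemma connected_closed_set_UNIV:
  assumes X: "pair_graph X" "pverts X = UNIV" "Digraph_Component.connected (with_proj X)"
    and S: "u \<in> S" "\<And>a b. a \<in> S \<Longrightarrow> (a, b) \<in> parcs X \<Longrightarrow> b \<in> S"
  shows "S = UNIV"
proof -
  have "b \<in> S" for b
  proof -
    have "(u, b) \<in> rtrancl_on UNIV ((parcs X)\<^sup>s)"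
      using X(2,3) by (simp add: connected_conv)
    then show ?thesis
      using S(1)
      by (induction rule: rtrancl_on_induct)
         (auto simp: symcl_def intro: S(2) dest: pair_graph_sym[OF X(1)])
  qed
  then show ?thesis by auto
qed

lemma digraph_iso_path_graph_2:
  assumes X: "pair_graph X" "pverts X = {a, b}" "(a, b) \<in> parcs X"
  shows "digraph_iso (with_proj X) (with_proj (path_graph 2))"
proof -
  interpret pair_graph X by fact
  have ab: "a \<noteq> b" using X(3) no_loops' by auto
  have "parcs X \<subseteq> {a, b} \<times> {a, b}"
    using wellformed' X(2) by (metis SigmaI subrelI)
  then have arcs: "parcs X = {(a, b), (b, a)}"
    using X(3) pair_graph_sym[OF X(1) X(3)] no_loops' by fastforce
  define f where "f x = (if x = a then 0 else 1 :: nat)" for x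
  define h where "h = \<lparr>iso_verts = f, iso_arcs = map_prod f f, iso_head = snd, iso_tail = fst\<rparr>"
  have "digraph_isomorphism h"
    unfolding digraph_isomorphism_def using ab wf_digraph_axioms
    by (auto simp: h_def f_def X(2) arcs inj_on_def)
  moreover have "with_proj (path_graph 2) = app_iso h (with_proj X)"
    using ab by (auto simp: with_proj_def app_iso_def h_def f_def path_graph_def X(2) arcs)
  ultimately show ?thesis
    unfolding digraph_iso_def by blast
qed

text \<open>Entry \<open>x\<close> of \<open>A^2 e\<close> at \<open>e = axis u 1\<close> counts the
  common neighbours of \<open>x\<close> and \<open>u\<close>. The entry 1 at \<open>u\<close> yields
  a single neighbour \<open>z\<close>; the zeros elsewhere leave \<open>z\<close> no neighbour but
  \<open>u\<close>, so \<open>{u, z}\<close> is closed under arcs.\<close>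

lemma adjacency_square_fixed_imp_path:
  fixes X :: "'v::finite pair_pre_digraph"
  assumes X: "pair_graph X" "pverts X = UNIV" "Digraph_Component.connected (with_proj X)"
    and fix_u: "adjacency_matrix X *v (adjacency_matrix X *v axis u 1) = axis u 1"
  shows "digraph_iso (with_proj X) (with_proj (path_graph 2))"
proof -
  have adj: "adjacency_matrix X *v axis u 1 = (\<chi> y. if (y, u) \<in> parcs X then 1 else 0)"
    by (simp add: vec_eq_iff matrix_vector_mult_def axis_def adjacency_matrix_def
        if_distrib[of "\<lambda>z. _ * z"] cong: if_cong)
  have entry: "(adjacency_matrix X *v (adjacency_matrix X *v axis u 1)) $ x
      = of_nat (card {y. (x, y) \<in> parcs X \<and> (y, u) \<in> parcs X})" for x
  proof -
    have "(adjacency_matrix X *v (adjacency_matrix X *v axis u 1)) $ x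
        = (\<Sum>y\<in>UNIV. if (x, y) \<in> parcs X \<and> (y, u) \<in> parcs X then 1 else 0)"
      unfolding adj by (auto simp: adjacency_matrix_def matrix_vector_mult_def intro!: sum.cong)
    then show ?thesis by (simp add: sum.If_cases)
  qed
  have "card {y. (u, y) \<in> parcs X \<and> (y, u) \<in> parcs X} = 1"
    using entry[of u] fix_u by (simp add: axis_def)
  then obtain z where z: "{y. (u, y) \<in> parcs X \<and> (y, u) \<in> parcs X} = {z}"
    by (auto simp: card_1_singleton_iff)
  have nbr_u: "y = z" if "(u, y) \<in> parcs X" for y
    using z pair_graph_sym[OF X(1) that] that by blast
  have nbr_z: "x = u" if "(z, x) \<in> parcs X" for x
  proof (rule ccontr)
    assume "x \<noteq> u"
    then have "card {y. (x, y) \<in> parcs X \<and> (y, u) \<in> parcs X} = 0"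
      using entry[of x] fix_u by (simp add: axis_def)
    then have "{y. (x, y) \<in> parcs X \<and> (y, u) \<in> parcs X} = {}"
      by simp
    then show False
      using z pair_graph_sym[OF X(1) that] by blast
  qed
  have "{u, z} = UNIV"
    by (rule connected_closed_set_UNIV[OF X, of u]) (use nbr_u nbr_z in auto)
  with X z show ?thesis
    by (intro digraph_iso_path_graph_2[of X u z]) auto
qed

section \<open>Rationality and the minimal polynomial\<close>

text \<open>A rational functional applied to the coordinates of \<open>w\<close> preserves the
  eigenvalue equation; normalising it at a nonzero coordinate keeps the vector nonzero, and
  \<open>D\<close> clears the denominators.\<close>

lemma integer_eigenvector_of_rational_eigenvalue:
  fixes B :: "complex^'n::finite^'n"
  assumes B: "\<And>i j. B $ i $ j \<in> \<int>" and w: "w \<noteq> 0" "B *v w = of_rat q *s w"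
  obtains v where "v \<noteq> 0" "\<And>i. v $ i \<in> \<int>" "B *v v = of_rat q *s v"
proof -
  obtain a where a: "w $ a \<noteq> 0"
    using w(1) by (auto simp: vec_eq_iff)
  obtain f where f: "\<And>x y. f (x + y) = f x + f y" "\<And>q x. f (of_rat q * x) = q * f x" "f (w $ a) = (1::rat)"
    using rational_functional_exists[OF a] by blast
  have f0: "f 0 = 0" using f(2)[of 0 0] by simp
  have f_sum: "f (\<Sum>j\<in>S. g j) = (\<Sum>j\<in>S. f (g j))" for S and g :: "'n \<Rightarrow> complex"
    by (induction S rule: infinite_finite_induct) (simp_all add: f f0)
  have "\<exists>d::int. d \<noteq> 0 \<and> of_int d * f (w $ i) \<in> \<int>" for i
  proof -
    obtain m n where mn: "f (w $ i) = Fract m n" "n > 0"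
      by (cases "f (w $ i)") auto
    then have "of_int n * f (w $ i) = of_int m"
      by (simp add: Fract_of_int_quotient)
    then show ?thesis using mn by (intro exI[of _ n]) auto
  qed
  then obtain d :: "'n \<Rightarrow> int" where d: "\<And>i. d i \<noteq> 0" "\<And>i. of_int (d i) * f (w $ i) \<in> \<int>"
    by metis
  define D where "D = (\<Prod>i\<in>UNIV. d i)"
  define v :: "complex^'n" where "v = (\<chi> i. of_rat (of_int D * f (w $ i)))"
  show thesis
  proof
    have "v $ a = of_int D"
      by (simp add: v_def f(3))
    moreover have "D \<noteq> 0"
      by (simp add: D_def d(1))
    ultimately show "v \<noteq> 0" by auto
    show "v $ i \<in> \<int>" for i
    proof -
      have "of_int D * f (w $ i) = of_int (\<Prod>j\<in>UNIV - {i}. d j) * (of_int (d i) * f (w $ i))"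
        by (simp add: D_def prod.remove[of UNIV i])
      then have "of_int D * f (w $ i) \<in> \<int>"
        using d(2)[of i] by (metis Ints_mult Ints_of_int)
      then show ?thesis
        by (auto simp: v_def elim!: Ints_cases)
    qed
    have "(\<Sum>j\<in>UNIV. B $ i $ j * of_rat (of_int D * f (w $ j))) = of_rat q * of_rat (of_int D * f (w $ i))" for i
    proof -
      have "\<exists>n. B $ i $ j = of_rat (of_int n)" for j
        using B[of i j] by (auto elim!: Ints_cases)
      then obtain n where n: "\<And>j. B $ i $ j = of_rat (of_int (n j))"
        by metis
      have "q * f (w $ i) = f ((B *v w) $ i)"
        by (simp add: w(2) f(2))
      also have "\<dots> = (\<Sum>j\<in>UNIV. of_int (n j) * f (w $ j))"
        unfolding matrix_vector_mult_def vec_lambda_beta f_sum n f(2) ..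
      finally have "(\<Sum>j\<in>UNIV. of_int (n j) * (of_int D * f (w $ j))) = q * (of_int D * f (w $ i))"
        by (simp add: mult.left_commute flip: sum_distrib_left)
      then have "of_rat (\<Sum>j\<in>UNIV. of_int (n j) * (of_int D * f (w $ j))) = complex_of_rat (q * (of_int D * f (w $ i)))"
        by simp
      then show ?thesis
        unfolding n of_rat_sum of_rat_mult .
    qed
    then show "B *v v = of_rat q *s v"
      by (simp add: vec_eq_iff matrix_vector_mult_def v_def)
  qed
qed

text \<open>Applying a \<open>\<rat>\<close>-linear map \<open>\<complex> \<rightarrow> \<rat>\<close> that fixes \<open>1\<close> to the coefficients of the minimal polynomial
  gives another monic annihilating polynomial of the same degree, hence the same one.\<close>

lemma minimal_poly_rational:
  fixes B :: "complex^'n::finite^'n"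
  assumes B: "\<And>i j. B $ i $ j \<in> \<int>" and x: "\<And>i. x $ i \<in> \<int>"
    and \<mu>: "poly_act B x \<mu> = 0" "lead_coeff \<mu> = 1"
    and minimal: "\<And>q. q \<noteq> 0 \<Longrightarrow> poly_act B x q = 0 \<Longrightarrow> degree \<mu> \<le> degree q"
  shows "coeff \<mu> k \<in> \<rat>"
proof -
  obtain f :: "complex \<Rightarrow> rat"
    where f: "\<And>x y. f (x + y) = f x + f y" "\<And>q x. f (of_rat q * x) = q * f x" "f 1 = 1"
    using rational_functional_exists[OF one_neq_zero] by blast
  define g where "g z = complex_of_rat (f z)" for z
  have g0: "g 0 = 0" using f(2)[of 0 0] by (simp add: g_def)
  have g_add: "g (a + b) = g a + g b" for a b
    by (simp add: g_def f(1) of_rat_add)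
  have g_int: "g (a * z) = a * g z" if a: "a \<in> \<int>" for a z
  proof -
    obtain n where "a = of_rat (of_int n)"
      using a by (auto elim!: Ints_cases)
    then show ?thesis by (simp only: g_def f(2) of_rat_mult)
  qed
  have g_sum: "g (\<Sum>j\<in>S. h j) = (\<Sum>j\<in>S. g (h j))" for S and h :: "'n \<Rightarrow> complex"
    by (induction S rule: infinite_finite_induct) (simp_all add: g_add g0)
  define \<nu> where "\<nu> = map_poly g \<mu>"
  have coeff_\<nu>: "coeff \<nu> i = g (coeff \<mu> i)" for i
    by (simp add: \<nu>_def coeff_map_poly g0)
  \<comment> \<open>Since \<open>B\<close> and \<open>x\<close> are integral, \<open>g\<close>
    passes through every step of the Horner scheme.\<close>
  have "poly_act B x (map_poly g p) $ i = g (poly_act B x p $ i)" for p i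
  proof (induction p arbitrary: i)
    case (pCons a p)
    have "map_poly g (pCons a p) = pCons (g a) (map_poly g p)"
      by (rule map_poly_pCons) (simp add: g0)
    then have "poly_act B x (map_poly g (pCons a p)) $ i
        = x $ i * g a + (\<Sum>j\<in>UNIV. B $ i $ j * poly_act B x (map_poly g p) $ j)"
      by (simp add: matrix_vector_mult_def mult.commute)
    also have "\<dots> = g (x $ i * a + (\<Sum>j\<in>UNIV. B $ i $ j * poly_act B x p $ j))"
      by (simp add: pCons.IH g_add g_sum g_int B x)
    finally show ?case
      by (simp add: matrix_vector_mult_def mult.commute)
  qed (simp add: g0)
  then have \<nu>0: "poly_act B x \<nu> = 0"
    by (simp add: \<nu>_def \<mu>(1) vec_eq_iff g0)
  have "\<nu> = \<mu>"
  proof (rule ccontr)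
    assume "\<nu> \<noteq> \<mu>"
    then have ne: "\<nu> - \<mu> \<noteq> 0" by simp
    then have deg: "degree \<mu> \<le> degree (\<nu> - \<mu>)"
      by (rule minimal) (simp add: poly_act_diff \<nu>0 \<mu>(1))
    \<comment> \<open>The leading coefficients cancel because \<open>g 1 = 1\<close>, which
      contradicts the degree bound \<open>deg\<close>.\<close>
    have "coeff (\<nu> - \<mu>) i = 0" if "degree \<mu> \<le> i" for i
    proof (cases "i = degree \<mu>")
      case True
      then show ?thesis by (simp add: coeff_\<nu> \<mu>(2) g_def f(3))
    next
      case False
      with that have "coeff \<mu> i = 0" by (simp add: coeff_eq_0)
      then show ?thesis by (simp add: coeff_\<nu> g0)
    qed
    from this[OF deg] ne show False by (simp only: leading_coeff_0_iff)
  qed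
  then have "coeff \<mu> k = g (coeff \<mu> k)"
    using coeff_\<nu>[of k] by simp
  then show ?thesis
    by (metis g_def Rats_of_rat)
qed

text \<open>The hypothesis \<open>spectrum\<close> concerns only the cyclic subspace of
  \<open>x\<close> under \<open>A^2\<close>. Once all roots of the minimal polynomial are known to
  be 1, self-adjointness excludes a multiple root, and the polynomial is
  \<open>[:- 1, 1:]\<close>.\<close>

lemma unimodular_square_fixes:
  fixes A :: "complex^'n::finite^'n" and s :: real
  assumes A: "\<And>i j. A $ i $ j \<in> \<int>" "det A \<in> {1, - 1}"
    and sa: "\<And>x y. (A *v x) \<bullet> y = x \<bullet> (A *v y)"
    and x: "\<And>i. x $ i \<in> \<int>" "x \<noteq> 0" and s: "s > 0"
    and spectrum: "\<And>p \<eta>. poly_act (A ** A) x p \<noteq> 0 \<Longrightarrow>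
      (A ** A) *v poly_act (A ** A) x p = \<eta> *s poly_act (A ** A) x p \<Longrightarrow>
      \<exists>n::int. \<eta> = of_real (s * of_int n ^ 2)"
  shows "A *v (A *v x) = x"
proof -
  define B where "B = A ** A"
  note spectrum = spectrum[folded B_def]
  have B_v: "B *v y = A *v (A *v y)" for y
    by (simp add: B_def matrix_vector_mul_assoc)
  have B_int: "B $ i $ j \<in> \<int>" for i j
    by (simp add: B_def matrix_matrix_mult_def Ints_sum Ints_mult A(1))
  obtain p where p: "p \<noteq> 0" "poly_act B x p = 0"
    and p_min: "\<And>q. q \<noteq> 0 \<Longrightarrow> poly_act B x q = 0 \<Longrightarrow> degree p \<le> degree q"
    using ex_has_least_nat[of "\<lambda>p. p \<noteq> 0 \<and> poly_act B x p = 0" _ degree]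
      annihilating_poly_exists[of B x] by (metis (no_types, lifting))
  define \<mu> where "\<mu> = smult (inverse (lead_coeff p)) p"
  have \<mu>: "poly_act B x \<mu> = 0" "lead_coeff \<mu> = 1" "\<mu> \<noteq> 0"
    using p by (auto simp: \<mu>_def poly_act_smult)
  have \<mu>_min: "degree \<mu> \<le> degree q" if "q \<noteq> 0" "poly_act B x q = 0" for q
    using p_min[OF that] p(1) by (simp add: \<mu>_def)
  obtain R where R: "size R = degree \<mu>" "\<mu> = (\<Prod>\<eta>\<in>#R. [:- \<eta>, 1:])"
    using alg_closed_imp_factorization[OF \<mu>(3)] \<mu>(2) by auto
  have "R \<noteq> {#}"
  proof
    assume "R = {#}"
    then show False using \<mu>(1) R(2) x(2) by (simp add: one_pCons)
  qed
  have root: "\<exists>w. w \<noteq> 0 \<and> B *v w = \<eta> *s w \<and> (\<exists>n::int. \<eta> = of_real (s * of_int n ^ 2) \<and> n \<noteq> 0)"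
    if "\<eta> \<in># R" for \<eta>
  proof -
    obtain R' where R': "R = add_mset \<eta> R'"
      using \<open>\<eta> \<in># R\<close> by (metis insert_DiffM)
    \<comment> \<open>Dropping the factor of \<eta> lowers the degree, so minimality keeps
      \<open>q(B) x\<close> nonzero; as \<mu> annihilates \<open>x\<close>, this vector is an
      eigenvector for \<eta>.\<close>
    define q where "q = (\<Prod>\<eta>\<in>#R'. [:- \<eta>, 1:])"
    have fact: "\<mu> = [:- \<eta>, 1:] * q"
      by (simp add: R(2) R' q_def)
    have "q \<noteq> 0" using fact \<mu>(3) by auto
    then have "degree q < degree \<mu>"
      unfolding fact by (subst degree_mult_eq) auto
    then have w0: "poly_act B x q \<noteq> 0"
      using \<mu>_min[OF \<open>q \<noteq> 0\<close>] by auto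
    have w: "B *v poly_act B x q = \<eta> *s poly_act B x q"
      using \<mu>(1) unfolding fact poly_act_linear_factor by simp
    obtain n :: int where n: "\<eta> = of_real (s * of_int n ^ 2)"
      using spectrum[OF w0 w] by blast
    \<comment> \<open>Invertibility of \<open>A\<close> excludes the eigenvalue 0; the roots are
      then positive, and so is \<open>m\<close> below.\<close>
    have ker: "y = 0" if "A *v y = 0" for y
    proof -
      have "det A \<noteq> 0" using A(2) by auto
      from cramer[OF this, of y 0] cramer[OF this, of 0 0] that show ?thesis
        by simp
    qed
    have "n \<noteq> 0"
    proof
      assume "n = 0"
      then have "A *v (A *v poly_act B x q) = 0"
        using w n by (simp add: B_v)
      then show False using ker w0 by blast
    qed
    with w0 w n show ?thesis by blast
  qed
  then have "\<forall>\<eta>. \<exists>k::int. \<eta> \<in># R \<longrightarrow> \<eta> = of_real (s * of_int k ^ 2) \<and> k \<noteq> 0"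
    by blast
  from choice[OF this] obtain n :: "complex \<Rightarrow> int"
    where "\<And>\<eta>. \<eta> \<in># R \<longrightarrow> \<eta> = of_real (s * of_int (n \<eta>) ^ 2) \<and> n \<eta> \<noteq> 0"
    by blast
  then have n: "\<eta> = of_real (s * of_int (n \<eta>) ^ 2)" "n \<eta> \<noteq> 0" if "\<eta> \<in># R" for \<eta>
    using that by blast+
  define m where "m = (\<Sum>\<eta>\<in>#R. n \<eta> ^ 2)"
  have "(\<Sum>\<eta>\<in>#Q. of_real (s * of_int (n \<eta>) ^ 2)) = complex_of_real s * of_int (\<Sum>\<eta>\<in>#Q. n \<eta> ^ 2)" for Q
    by (induction Q) (simp_all add: distrib_left)
  moreover have "(\<Sum>\<eta>\<in>#R. \<eta>) = (\<Sum>\<eta>\<in>#R. of_real (s * of_int (n \<eta>) ^ 2))"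
    by (intro arg_cong[of _ _ sum_mset] image_mset_cong n(1))
  ultimately have m: "(\<Sum>\<eta>\<in>#R. \<eta>) = of_real s * of_int m"
    by (simp only: m_def)
  have "m > 0"
  proof -
    have nonneg: "(\<Sum>\<eta>\<in>#Q. n \<eta> ^ 2) \<ge> 0" for Q
      by (induction Q) simp_all
    obtain \<eta> Q where "R = add_mset \<eta> Q"
      using \<open>R \<noteq> {#}\<close> by (metis multiset_cases)
    moreover from this have "n \<eta> ^ 2 > 0"
      using n(2)[of \<eta>] by simp
    ultimately show ?thesis
      using nonneg[of Q] by (simp add: m_def add_pos_nonneg)
  qed
  \<comment> \<open>The subleading coefficient is \<open>- s\<close> times a positive integer, so \<open>s\<close> is rational.\<close>
  have "coeff \<mu> (degree \<mu> - 1) \<in> \<rat>"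
    by (rule minimal_poly_rational[OF B_int x(1) \<mu>(1,2) \<mu>_min])
  then have "of_real s * of_int m \<in> (\<rat> :: complex set)"
    using coeff_prod_linear_factors[OF \<open>R \<noteq> {#}\<close>] m R by (metis Rats_minus_iff)
  then have "of_real s * of_int m / of_int m \<in> (\<rat> :: complex set)"
    by (intro Rats_divide) auto
  then have s_rat: "of_real s \<in> (\<rat> :: complex set)"
    using \<open>m > 0\<close> by simp
  have all_1: "\<eta> = 1" if \<eta>_R: "\<eta> \<in># R" for \<eta>
  proof -
    have \<eta>: "\<eta> = of_real s * of_int (n \<eta>) ^ 2"
      by (rule trans[OF n(1)[OF \<eta>_R]]) simp
    then have "\<eta> \<in> \<rat>"
      using s_rat by (metis Rats_mult Rats_power Rats_of_int)
    then obtain q where q: "\<eta> = of_rat q" by (auto elim: Rats_cases)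
    obtain w where "w \<noteq> 0 \<and> B *v w = \<eta> *s w"
      using root[OF \<eta>_R] by (elim exE conjE) (rule that, rule conjI)
    then have w: "w \<noteq> 0" "B *v w = of_rat q *s w"
      using q by simp_all
    obtain v where v: "v \<noteq> 0" "\<And>i. v $ i \<in> \<int>" "B *v v = of_rat q *s v"
      using integer_eigenvector_of_rational_eigenvalue[OF B_int w] by blast
    have "s * of_int (n \<eta>) ^ 2 = 1"
    proof (rule unimodular_square_eigenvalue[OF A v(2,1)])
      show "A *v (A *v v) = complex_of_real (s * of_int (n \<eta>) ^ 2) *s v"
        using v(3) unfolding B_v trans[OF n(1)[OF \<eta>_R, symmetric] q] .
      show "s * of_int (n \<eta>) ^ 2 > 0"
        using s n(2)[OF \<eta>_R] by simp
    qed
    then show ?thesis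
      by (subst n(1)[OF \<eta>_R]) (simp only: of_real_1)
  qed
  \<comment> \<open>With \<open>N = B - 1\<close> self-adjoint, \<open>N (N y) = 0\<close> forces
    \<open>N y = 0\<close>.\<close>
  have sa_N: "(B *v y - y) \<bullet> z = y \<bullet> (B *v z - z)" for y z
    by (simp add: inner_diff_left inner_diff_right B_v sa)
  obtain \<eta> R' where "R = add_mset \<eta> R'"
    using \<open>R \<noteq> {#}\<close> by (metis multiset_cases)
  with all_1[of \<eta>] have R': "R = add_mset 1 R'"
    by simp
  show ?thesis
  proof (cases "R' = {#}")
    case True
    then have "\<mu> = [:- 1, 1:] * [:1:]"
      by (simp add: R(2) R')
    then have "B *v x - x = 0"
      using \<mu>(1) by (metis poly_act_linear_factor poly_act_pCons poly_act_0 vector_smult_lid matrix_vector_mult_0_right add.right_neutral)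
    then show ?thesis by (simp add: B_v)
  next
    case False
    then obtain \<theta> R'' where "R' = add_mset \<theta> R''"
      by (metis multiset_cases)
    with all_1[of \<theta>] R' have R'': "R' = add_mset 1 R''"
      by simp
    \<comment> \<open>With two roots 1 split off, one of them can be cancelled by
      \<open>sa_N\<close>, leaving an annihilating polynomial of smaller degree.\<close>
    define q where "q = (\<Prod>\<eta>\<in>#R''. [:- \<eta>, 1:])"
    define y where "y = poly_act B x q"
    have fact: "\<mu> = [:- 1, 1:] * ([:- 1, 1:] * q)"
      by (simp add: R(2) R' R'' q_def)
    have Ny: "poly_act B x ([:- 1, 1:] * q) = B *v y - y"
      unfolding poly_act_linear_factor y_def by simp
    have "B *v (B *v y - y) - (B *v y - y) = 0"
      using \<mu>(1) unfolding fact poly_act_linear_factor[of B x 1 "[:- 1, 1:] * q"] Ny by simp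
    then have "(B *v y - y) \<bullet> (B *v y - y) = 0"
      unfolding sa_N by simp
    then have "poly_act B x ([:- 1, 1:] * q) = 0"
      unfolding Ny by simp
    moreover have nz: "[:- 1, 1:] * q \<noteq> 0"
      using fact \<mu>(3) by auto
    ultimately have "degree \<mu> \<le> degree ([:- 1, 1:] * q)"
      using \<mu>_min by blast
    moreover have "degree \<mu> = Suc (degree ([:- 1, 1:] * q))"
      unfolding fact by (subst degree_mult_eq[OF _ nz]) auto
    ultimately show ?thesis by simp
  qed
qed

section \<open>Perfect state transfer and the spectrum\<close>

text \<open>\<open>E\<close> and \<open>E'\<close> are \<open>exp(itA)\<close> and
  \<open>exp(-itA)\<close>. The relation between them at \<open>x\<close> holds on an
  \<open>A\<close>-invariant subspace \<open>S\<close>; at an eigenvector of \<open>A\<close> in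
  \<open>S\<close> it becomes a scalar equation for the eigenvalue.\<close>

lemma exp_parity_eigenvalue:
  fixes A :: "complex^'n::finite^'n" and t :: real
  assumes t: "t > 0" and \<epsilon>: "\<epsilon> ^ 2 = 1"
    and E: "E = matrix_exp (\<chi> a b. \<i> * of_real t * A $ a $ b)"
    and E': "E' = matrix_exp (\<chi> a b. - (\<i> * of_real t * A $ a $ b))"
    and x: "E' *v x = \<epsilon> *s (E *v x)"
    and w: "w = poly_act (A ** A) x p" "w \<noteq> 0" "(A ** A) *v w = \<eta> *s w"
  shows "\<exists>n::int. \<eta> = of_real ((pi / (2 * t))\<^sup>2 * of_int n ^ 2)"
proof -
  have scaled: "(\<chi> a b. c * A $ a $ b) *v y = c *s (A *v y)" for c y
    by (simp add: matrix_vector_mult_def vec_eq_iff sum_distrib_left mult.assoc)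
  have comm: "A ** (\<chi> a b. c * A $ a $ b) = (\<chi> a b. c * A $ a $ b) ** A" for c
    by (simp add: matrix_matrix_mult_def vec_eq_iff mult_ac)
  have A_E: "A ** E = E ** A" "A ** E' = E' ** A"
    unfolding E E' using matrix_exp_commute[OF comm, of "\<i> * of_real t"]
      matrix_exp_commute[OF comm, of "- (\<i> * of_real t)"] by simp_all
  define S where "S = {y. E' *v y = \<epsilon> *s (E *v y)}"
  have S_A: "A *v y \<in> S" if "y \<in> S" for y
  proof -
    have "E' *v (A *v y) = A *v (E' *v y)"
      by (simp add: matrix_vector_mul_assoc A_E)
    also have "\<dots> = \<epsilon> *s (E *v (A *v y))"
      using that by (simp add: S_def matrix_vector_mult_smult matrix_vector_mul_assoc A_E)
    finally show ?thesis by (simp add: S_def)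
  qed
  have S_lin: "c *s y + z \<in> S" if "y \<in> S" "z \<in> S" for c y z
    using that by (simp add: S_def matrix_vector_right_distrib matrix_vector_mult_smult
        vec.scale_right_distrib mult.commute)
  have "poly_act (A ** A) x q \<in> S" for q
  proof (induction q)
    case 0
    then show ?case by (simp add: S_def)
  next
    case (pCons a q)
    then have "A *v (A *v poly_act (A ** A) x q) \<in> S"
      by (intro S_A)
    moreover have "x \<in> S" using x by (simp add: S_def)
    ultimately show ?case
      by (simp add: S_lin matrix_vector_mul_assoc)
  qed
  then have wS: "w \<in> S" by (simp add: w(1))
  have AAw: "A *v (A *v w) = \<eta> *s w"
    using w(3) by (simp add: matrix_vector_mul_assoc)
  \<comment> \<open>With \<sigma> = \<open>csqrt\<close> \<eta>, the product
    \<open>(A - \<sigma>)(A + \<sigma>)\<close> kills \<open>w\<close>: either \<open>w\<close> is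
    an eigenvector for -\<sigma>, or \<open>(A + \<sigma>) w\<close> is one for \<sigma>.\<close>
  obtain \<rho> v where \<rho>: "\<rho> ^ 2 = \<eta>" and v: "v \<in> S" "v \<noteq> 0" "A *v v = \<rho> *s v"
  proof (cases "csqrt \<eta> *s w + A *v w = 0")
    case True
    then have "A *v w = (- csqrt \<eta>) *s w"
      by (simp add: eq_neg_iff_add_eq_0 add.commute)
    with wS w(2) show thesis
      by (intro that[of "- csqrt \<eta>" w]) auto
  next
    case False
    have "A *v (csqrt \<eta> *s w + A *v w) = csqrt \<eta> *s (A *v w) + (csqrt \<eta> * csqrt \<eta>) *s w"
      by (simp add: matrix_vector_right_distrib matrix_vector_mult_smult AAw flip: power2_eq_square)
    also have "\<dots> = csqrt \<eta> *s (csqrt \<eta> *s w + A *v w)"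
      by (simp add: vec.scale_right_distrib add.commute)
    finally show thesis
      using False S_lin[OF wS S_A[OF wS]] by (intro that[of "csqrt \<eta>"]) auto
  qed
  let ?z = "\<i> * of_real t * \<rho>"
  have "E *v v = exp ?z *s v"
    unfolding E by (rule matrix_exp_eigenvector) (simp add: scaled v(3))
  moreover have "E' *v v = exp (- ?z) *s v"
    unfolding E' using matrix_exp_eigenvector[of "\<chi> a b. - (\<i> * of_real t) * A $ a $ b" v "- ?z"]
      scaled[of "- (\<i> * of_real t)" v] by (simp add: v(3))
  ultimately have "exp (- ?z) *s v = (\<epsilon> * exp ?z) *s v"
    using v(1) by (simp add: S_def)
  then have "exp (- ?z) = \<epsilon> * exp ?z"
    using v(2) by (simp only: vec.scale_cancel_right) simp
  \<comment> \<open>Squaring removes the sign \<epsilon>. Then \<open>4 * ?z\<close> is a multiple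
    of \<open>2 pi i\<close>, which makes \<rho> real and a multiple of
    \<open>pi / (2 * t)\<close>.\<close>
  then have "exp (- ?z) ^ 2 = exp ?z ^ 2"
    by (simp add: power_mult_distrib \<epsilon>)
  then have "exp (- (2 * ?z)) = exp (2 * ?z)"
    by (simp add: power2_eq_square mult_ac flip: exp_add)
  then have "exp (2 * ?z + 2 * ?z) = 1"
    by (metis exp_add exp_minus_inverse mult.commute)
  then have "exp (4 * ?z) = 1" by (simp add: mult_ac)
  then obtain n :: int where "Re (4 * ?z) = 0" "Im (4 * ?z) = of_int (2 * n) * pi"
    unfolding exp_eq_1 by blast
  then have "Im \<rho> = 0" "Re \<rho> = pi / (2 * t) * of_int n"
    using t by (auto simp: field_simps)
  then have "\<rho> = of_real (pi / (2 * t) * of_int n)"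
    by (simp add: complex_eq_iff)
  then show ?thesis
    using \<rho> by (intro exI[of _ n]) (auto simp: power_mult_distrib power_divide)
qed

theorem theorem15:
  fixes X :: "'v::finite pair_pre_digraph"
  assumes "pair_graph X"
    and "pverts X = UNIV"
    and "Digraph_Component.connected (with_proj X)"
    and "bipartite X"
    and "\<exists>!M. perfect_matching X M"
    and "\<not> digraph_iso (with_proj X) (with_proj (path_graph 2))"
  shows "\<forall>u v. u \<noteq> v \<longrightarrow> \<not> perfect_state_transfer X u v"
proof (intro allI impI notI)
  fix u v :: 'v
  assume uv: "u \<noteq> v" and pst: "perfect_state_transfer X u v"
  define A where "A = adjacency_matrix X"
  define e :: "complex^'v" where "e = axis u 1"
  obtain t \<gamma> where t: "t \<ge> 0"
    and Ut: "matrix_exp (\<chi> a b. \<i> * complex_of_real t * A $ a $ b) *v e = \<gamma> *s axis v 1"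
    using pst unfolding perfect_state_transfer_def A_def e_def by blast
  define E where "E = matrix_exp (\<chi> a b. \<i> * complex_of_real t * A $ a $ b)"
  define E' where "E' = matrix_exp (\<chi> a b. - (\<i> * complex_of_real t * A $ a $ b))"
  have E_col: "(N *v e) $ a = N $ a $ u" for N :: "complex^'v^'v" and a
    by (simp add: e_def matrix_vector_mult_def axis_def if_distrib[of "\<lambda>z. _ * z"] cong: if_cong)
  \<comment> \<open>At time 0 the exponential fixes \<open>e\<close>, which is not a multiple of
    \<open>axis v 1\<close>.\<close>
  have "t > 0"
  proof (rule ccontr)
    assume "\<not> t > 0"
    with t have "t = 0" by simp
    then have "(\<chi> a b. \<i> * complex_of_real t * A $ a $ b) *v e = 0 *s e"
      by (simp add: matrix_vector_mult_def vec_eq_iff)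
    then have "e = \<gamma> *s axis v 1"
      using matrix_exp_eigenvector Ut by (metis exp_zero vector_smult_lid)
    then have "e $ u = (\<gamma> *s axis v 1) $ u" by simp
    then show False using uv by (simp add: e_def axis_def)
  qed
  obtain U W where UW: "U \<inter> W = {}"
      "\<And>a b. (a, b) \<in> parcs X \<Longrightarrow> a \<in> U \<and> b \<in> W \<or> a \<in> W \<and> b \<in> U"
    using assms(4) unfolding bipartite_def by (metis (no_types, lifting) case_prodD)
  \<comment> \<open>The signs of the two colour classes: every arc joins opposite signs, so
    conjugation by them negates \<open>A\<close>.\<close>
  define d :: "'v \<Rightarrow> complex" where "d a = (if a \<in> U then 1 else - 1)" for a
  have dd: "d a * d a = 1" for a by (simp add: d_def)
  have "- (\<i> * complex_of_real t * A $ a $ b) = d a * d b * (\<i> * complex_of_real t * A $ a $ b)" for a b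
    using UW by (auto simp: A_def adjacency_matrix_def d_def dest: UW(2))
  then have E'_E: "E' $ a $ b = d a * d b * E $ a $ b" for a b
    unfolding E_def E'_def by (intro matrix_exp_diagonal_conj dd) simp
  \<comment> \<open>Column \<open>u\<close> of \<open>E\<close> vanishes outside row
    \<open>v\<close>, so the row sign \<open>d a\<close> can be replaced by the constant
    \<open>d v\<close>.\<close>
  have E'e: "E' *v e = (d v * d u) *s (E *v e)"
  proof -
    have "(E' *v e) $ a = ((d v * d u) *s (E *v e)) $ a" for a
    proof (cases "a = v")
      case False
      then have "E $ a $ u = 0"
        using arg_cong[OF Ut, of "\<lambda>y. y $ a"] by (simp add: E_col axis_def flip: E_def)
      then show ?thesis by (simp add: E_col E'_E)
    qed (simp add: E_col E'_E)
    then show ?thesis by (simp add: vec_eq_iff)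
  qed
  have \<epsilon>: "(d v * d u) ^ 2 = 1"
    by (simp add: d_def)
  have "A *v (A *v e) = e"
  proof (rule unimodular_square_fixes)
    show "A $ i $ j \<in> \<int>" for i j
      by (simp add: A_def adjacency_matrix_def)
    show "det A \<in> {1, - 1}"
      unfolding A_def using assms(1,2,4,5) by (rule det_adjacency_matrix_unimodular)
    show "e $ i \<in> \<int>" for i
      by (simp add: e_def axis_def)
    show "e \<noteq> 0"
      by (simp add: e_def axis_eq_0_iff)
    show "(pi / (2 * t))\<^sup>2 > 0"
      using \<open>t > 0\<close> by simp
    show "(A *v x) \<bullet> y = x \<bullet> (A *v y)" for x y
    proof -
      have "(A $ i $ j * x $ j) \<bullet> y $ i = x $ j \<bullet> (A $ j $ i * y $ i)" for i j
        using pair_graph_sym[OF assms(1)] by (auto simp: A_def adjacency_matrix_def)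
      then have "(A *v x) \<bullet> y = (\<Sum>i\<in>UNIV. \<Sum>j\<in>UNIV. x $ j \<bullet> (A $ j $ i * y $ i))"
        by (simp add: inner_vec_def matrix_vector_mult_def inner_sum_left)
      also have "\<dots> = x \<bullet> (A *v y)"
        by (subst sum.swap) (simp add: inner_vec_def matrix_vector_mult_def inner_sum_right)
      finally show ?thesis .
    qed
  qed (use exp_parity_eigenvalue[OF \<open>t > 0\<close> \<epsilon> E_def E'_def E'e refl] in blast)
  then have "digraph_iso (with_proj X) (with_proj (path_graph 2))"
    using adjacency_square_fixed_imp_path[OF assms(1-3), of u] by (simp add: A_def e_def)
  with assms(6) show False by simp
qed

end
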